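(* Let $\mathbf{k}$ be an arbitrary field. For each integer $n\geq 1$ there exist a differential graded $\mathbf{k}$-module $(V,d)$ and an approximation $d+td_1+t^2d_2+\cdots+t^nd_n$ to a differential on $V[[t]]$, with $d_1,\dots,d_n\in C^1(V)$, which is obstructed (at order $n$).
   Context: Let $\mathbf{k}$ be a field. A graded $\mathbf{k}$-module is $V=\sum_{p\in\mathbf{Z}}V_p$ (direct sum), with elements of $V_p$ homogeneous of degree $p$. A $\mathbf{k}$-linear map $f:V\to V$ has degree $q$ if $f(V_p)\subset V_{p+q}$ for all $p$; the set of such maps is $\mathrm{Hom}_{\mathbf{k}}^{q}(V,V)$. A differential graded $\mathbf{k}$-module (d.g.m.) is a pair $(V,d)$ with $V$ a graded $\mathbf{k}$-module and $d:V\to V$ a $\mathbf{k}$-linear map of degree $-1$ with $d^2=0$. The $p$-cochains on $V$ are $C^p(V)=\mathrm{Hom}_{\mathbf{k}}^{-p}(V,V)$, and the coboundary $\delta=\delta^p:C^p(V)\to C^{p+1}(V)$ is $\delta^p(f)=df-(-1)^p fd$; in particular $\delta(f)=df+fd$ for $f\in C^1(V)$. One has $\delta^2=0$. Let $t$ be an indeterminate of degree $0$ and $V[[t]]=\{\sum_{i\geq 0} t^i v_i\mid v_i\in V\}$, to which $\mathbf{k}$-linear maps $f:V\to V$ are extended $\mathbf{k}[[t]]$-linearly by $f(\sum t^iv_i)=\sum t^if(v_i)$. Given $d_1,\dots,d_n\in C^1(V)$, set $\mathcal{O}_0=0$ and, for $1\leq m\leq n$, $\mathcal{O}_m=-\sum_{i=1}^{m}d_i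 d_{m-i+1}\in C^2(V)$. The expression $d+td_1+\cdots+t^nd_n$ is an approximation (of order $n$) to a differential on $V[[t]]$ if $\delta(d_k)=\mathcal{O}_{k-1}$ for all $1\leq k\leq n$. Such an approximation is obstructed at order $n$ if $\mathcal{O}_n$ fails to cobound, i.e. there is no $f\in C^1(V)$ with $\delta(f)=\mathcal{O}_n$. *)

theory Defs
  imports Complex_Main "HOL-Library.Function_Algebras"
begin

(* A graded k-module is given internally, by an independent family of subspaces V p of some
   ambient vector space.  The module itself is their sum (the set total below), which may be a
   proper subspace of the ambient type. *)
locale graded_space = vector_space scale
  for scale :: "'k::field \<Rightarrow> 'v::ab_group_add \<Rightarrow> 'v" +
  fixes V :: "int \<Rightarrow> 'v set"
  assumes subspace_component: "subspace (V p)"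
    and components_independent:
      "\<lbrakk>finite P; \<And>p. p \<in> P \<Longrightarrow> x p \<in> V p; (\<Sum>p\<in>P. x p) = 0; p \<in> P\<rbrakk> \<Longrightarrow> x p = 0"
begin

definition total :: "'v set" where
  "total = span (\<Union>p. V p)"

(* Only the values on total are constrained: an endomorphism of the module is represented by
   any function on the ambient type that restricts to it, so equations between endomorphisms
   are always stated pointwise on total. *)
definition linear_endo :: "('v \<Rightarrow> 'v) \<Rightarrow> bool" where
  "linear_endo f \<longleftrightarrow>
     (\<forall>v\<in>total. f v \<in> total) \<and>
     (\<forall>v\<in>total. \<forall>w\<in>total. f (v + w) = f v + f w) \<and>
     (\<forall>c. \<forall>v\<in>total. f (scale c v) = scale c (f v))"

definition Hom :: "int \<Rightarrow> ('v \<Rightarrow> 'v) set" where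
  "Hom q = {f. linear_endo f \<and> (\<forall>p. f ` V p \<subseteq> V (p + q))}"

definition cochains :: "int \<Rightarrow> ('v \<Rightarrow> 'v) set" where
  "cochains p = Hom (- p)"

end

locale dg_module = graded_space scale V
  for scale :: "'k::field \<Rightarrow> 'v::ab_group_add \<Rightarrow> 'v" and V :: "int \<Rightarrow> 'v set" +
  fixes d :: "'v \<Rightarrow> 'v"
  assumes d_degree: "d \<in> Hom (- 1)"
    and d_squared: "v \<in> total \<Longrightarrow> d (d v) = 0"
begin

definition coboundary :: "int \<Rightarrow> ('v \<Rightarrow> 'v) \<Rightarrow> 'v \<Rightarrow> 'v" where
  "coboundary p f = (\<lambda>v. d (f v) - scale ((- 1) powi p) (f (d v)))"

(* For m = 0 the sum is empty, so the obstruction of order 0 vanishes. *)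
definition obstruction :: "(nat \<Rightarrow> 'v \<Rightarrow> 'v) \<Rightarrow> nat \<Rightarrow> 'v \<Rightarrow> 'v" where
  "obstruction ds m = (\<lambda>v. - (\<Sum>i = 1..m. ds i (ds (m - i + 1) v)))"

(* The expression d + t d_1 + ... + t^n d_n is given by its coefficients d_k = ds k for
   1 \<le> k \<le> n; all other values of ds are irrelevant. *)
definition approximation :: "nat \<Rightarrow> (nat \<Rightarrow> 'v \<Rightarrow> 'v) \<Rightarrow> bool" where
  "approximation n ds \<longleftrightarrow>
     (\<forall>k\<in>{1..n}. ds k \<in> cochains 1) \<and>
     (\<forall>k\<in>{1..n}. \<forall>v\<in>total. coboundary 1 (ds k) v = obstruction ds (k - 1) v)"

definition obstructed :: "nat \<Rightarrow> (nat \<Rightarrow> 'v \<Rightarrow> 'v) \<Rightarrow> bool" where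
  "obstructed n ds \<longleftrightarrow>
     \<not> (\<exists>f\<in>cochains 1. \<forall>v\<in>total. coboundary 1 f v = obstruction ds n v)"

end

end

theory Submission
  imports Defs
begin

text \<open>
  When \<open>d = 0\<close>, every coboundary vanishes. A family \<open>d\<^sub>1, \<dots>, d\<^sub>n\<close> is then an approximation exactly
  when the coefficients of \<open>t\<^sup>2, \<dots>, t\<^sup>n\<close> in \<open>(t d\<^sub>1 + \<dots> + t\<^sup>n d\<^sub>n)\<^sup>2\<close> are zero, and it is obstructed
  exactly when the coefficient of \<open>t\<^bsup>n+1\<^esup>\<close> is not.

  This is achieved by a path of length two: let \<open>e\<^sub>2, e\<^sub>1, e\<^sub>0\<close> be vectors of degrees 2, 1, 0, and
  consider the operator \<open>D\<close> with \<open>D e\<^sub>2 = t\<^sup>n e\<^sub>1\<close>, \<open>D e\<^sub>1 = t e\<^sub>0\<close> and \<open>D e\<^sub>0 = 0\<close>. The only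
  nonzero value of \<open>D\<^sup>2\<close> on these vectors is \<open>D\<^sup>2 e\<^sub>2 = t\<^bsup>n+1\<^esup> e\<^sub>0\<close>, so the square is concentrated in
  the one power of \<open>t\<close> that is wanted. For \<open>n = 1\<close> both arrows have weight \<open>t\<close> and belong to the
  same map \<open>d\<^sub>1\<close>.

  The graded module is realized as the space of finitely supported sequences, the unit vector
  with index \<open>i\<close> having degree \<open>i\<close>; \<open>D\<close> kills those of index above 2.
\<close>

context graded_space
begin

lemma component_subset_total: "V p \<subseteq> total"
  unfolding total_def by (blast intro: span_base)

lemma zero_in_Hom: "(\<lambda>v. 0) \<in> Hom q"
  by (auto simp: Hom_def linear_endo_def total_def span_zero subspace_0[OF subspace_component])

lemma zero_differential: "dg_module scale V (\<lambda>v. 0)"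
  by unfold_locales (auto simp: zero_in_Hom)

lemma Hom_zero:
  assumes "f \<in> Hom q"
  shows "f 0 = 0"
proof -
  have "0 \<in> total"
    by (simp add: total_def span_zero)
  then have "f (0 + 0) = f 0 + f 0"
    using assms unfolding Hom_def linear_endo_def by blast
  then show ?thesis
    by simp
qed

lemma approximation_zero_differential:
  assumes "\<And>k. k \<in> {1..n} \<Longrightarrow> ds k \<in> cochains 1"
    and "\<And>m v. m < n \<Longrightarrow> v \<in> total \<Longrightarrow> dg_module.obstruction ds m v = 0"
  shows "dg_module.approximation scale V (\<lambda>v. 0) n ds"
proof -
  interpret dg_module scale V "\<lambda>v. 0"
    by (rule zero_differential)
  show ?thesis
    unfolding approximation_def
    using assms by (force simp: coboundary_def cochains_def intro: Hom_zero)
qed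

lemma obstructed_zero_differential:
  assumes "v \<in> total" and "dg_module.obstruction ds n v \<noteq> 0"
  shows "dg_module.obstructed scale V (\<lambda>v. 0) n ds"
proof -
  interpret dg_module scale V "\<lambda>v. 0"
    by (rule zero_differential)
  show ?thesis
    unfolding obstructed_def
    using assms by (auto simp: coboundary_def cochains_def Hom_zero)
qed

end

definition scale_seq :: "'k::field \<Rightarrow> (nat \<Rightarrow> 'k) \<Rightarrow> nat \<Rightarrow> 'k" where
  "scale_seq c x = (\<lambda>i. c * x i)"

definition line :: "int \<Rightarrow> (nat \<Rightarrow> 'k::field) set" where
  "line p = {x. \<forall>i. int i \<noteq> p \<longrightarrow> x i = 0}"

interpretation seq: graded_space scale_seq "line :: int \<Rightarrow> (nat \<Rightarrow> 'k::field) set"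
proof -
  interpret vector_space "scale_seq :: 'k \<Rightarrow> _"
    by unfold_locales (auto simp: scale_seq_def fun_eq_iff algebra_simps)
  show "graded_space scale_seq (line :: int \<Rightarrow> (nat \<Rightarrow> 'k) set)"
  proof unfold_locales
    show "subspace (line p :: (nat \<Rightarrow> 'k) set)" for p
      by (auto simp: subspace_def line_def scale_seq_def)
  next
    fix P :: "int set" and x :: "int \<Rightarrow> nat \<Rightarrow> 'k" and p
    assume P: "finite P" "\<And>p. p \<in> P \<Longrightarrow> x p \<in> line p" "(\<Sum>p\<in>P. x p) = 0" "p \<in> P"
    have eval: "(\<Sum>p\<in>Q. x p) i = (\<Sum>p\<in>Q. x p i)" for Q i
      by (induction Q rule: infinite_finite_induct) auto
    have "x p i = 0" for i
    proof (cases "int i = p")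
      case True
      have "(\<Sum>q\<in>P. x q i) = (\<Sum>q\<in>P. if q = p then x q i else 0)"
        using P(2) True by (intro sum.cong) (auto simp: line_def)
      also have "\<dots> = x p i"
        using P(1,4) by simp
      finally show ?thesis
        using eval[of P i] P(3) by simp
    next
      case False
      then show ?thesis
        using P(2,4) by (auto simp: line_def)
    qed
    then show "x p = 0"
      by (simp add: fun_eq_iff)
  qed
qed

text \<open>The coefficient of \<open>t\<^sup>k\<close> in the operator \<open>D\<close> that sends \<open>e\<^sub>2\<close> to \<open>t\<^sup>n e\<^sub>1\<close> and \<open>e\<^sub>1\<close> to \<open>t e\<^sub>0\<close>.\<close>

definition path_map :: "nat \<Rightarrow> nat \<Rightarrow> (nat \<Rightarrow> 'k::field) \<Rightarrow> nat \<Rightarrow> 'k" where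
  "path_map n k x = (\<lambda>i. if i = 0 \<and> k = 1 then x 1 else if i = 1 \<and> k = n then x 2 else 0)"

lemma path_map_in_total: "path_map n k x \<in> seq.total"
proof -
  define y where "y j = (\<lambda>i. if i = j then path_map n k x j else 0)" for j
  have "y j \<in> line (int j)" for j
    by (auto simp: y_def line_def)
  then have "y 0 + y 1 \<in> seq.total"
    using seq.component_subset_total unfolding seq.total_def
    by (blast intro: seq.span_add)
  also have "y 0 + y 1 = path_map n k x"
    by (auto simp: y_def path_map_def fun_eq_iff)
  finally show ?thesis .
qed

lemma path_map_cochain: "(path_map n k :: (nat \<Rightarrow> 'k::field) \<Rightarrow> _) \<in> seq.cochains 1"
proof -
  have "path_map n k ` line p \<subseteq> (line (p - 1) :: (nat \<Rightarrow> 'k) set)" for p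
    by (auto simp: path_map_def line_def)
  moreover have "seq.linear_endo (path_map n k :: (nat \<Rightarrow> 'k) \<Rightarrow> _)"
    unfolding seq.linear_endo_def
    by (auto simp: path_map_in_total) (auto simp: path_map_def scale_seq_def fun_eq_iff)
  ultimately show ?thesis
    by (simp add: seq.cochains_def seq.Hom_def)
qed

text \<open>The path can be traversed in one order only, so a single pair of coefficients composes to
  something nonzero, the one with weights \<open>t\<close> and \<open>t\<^sup>n\<close>.\<close>

lemma path_map_path_map:
  "path_map n i (path_map n j x) = (if i = 1 \<and> j = n then (\<lambda>l. if l = 0 then x 2 else 0) else 0)"
  by (auto simp: path_map_def fun_eq_iff)

lemma obstruction_path_map:
  assumes "n \<ge> 1"
  shows "dg_module.obstruction (path_map n) m x
    = (if m = n then (\<lambda>l. if l = 0 then - x 2 else 0) else 0)"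
proof -
  interpret dg_module scale_seq line "\<lambda>v :: nat \<Rightarrow> 'a. 0"
    by (rule seq.zero_differential)
  have "(\<Sum>i = 1..m. path_map n i (path_map n (m - i + 1) x))
      = (\<Sum>i = 1..m. if i = 1 then (if m = n then (\<lambda>l. if l = 0 then x 2 else 0) else 0) else 0)"
    by (rule sum.cong) (auto simp: path_map_path_map)
  also have "\<dots> = (if m = n then (\<lambda>l. if l = 0 then x 2 else 0) else 0)"
    using assms by (auto simp: sum.delta)
  finally show ?thesis
    by (auto simp: obstruction_def fun_eq_iff)
qed

theorem theorem3p2:
  fixes n :: nat
  assumes "n \<ge> 1"
  shows "\<exists>(scale :: 'k::field \<Rightarrow> (nat \<Rightarrow> 'k) \<Rightarrow> (nat \<Rightarrow> 'k))
            (V :: int \<Rightarrow> (nat \<Rightarrow> 'k) set)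
            (d :: (nat \<Rightarrow> 'k) \<Rightarrow> (nat \<Rightarrow> 'k))
            (ds :: nat \<Rightarrow> (nat \<Rightarrow> 'k) \<Rightarrow> (nat \<Rightarrow> 'k)).
           dg_module scale V d \<and>
           dg_module.approximation scale V d n ds \<and>
           dg_module.obstructed scale V d n ds"
proof (intro exI conjI)
  show "dg_module scale_seq line (\<lambda>v :: nat \<Rightarrow> 'k. 0)"
    by (rule seq.zero_differential)
  show "dg_module.approximation scale_seq line (\<lambda>v :: nat \<Rightarrow> 'k. 0) n (path_map n)"
    by (rule seq.approximation_zero_differential)
      (simp_all add: path_map_cochain obstruction_path_map[OF assms])
  define e :: "nat \<Rightarrow> 'k" where "e = (\<lambda>i. if i = 2 then 1 else 0)"
  have "e \<in> line 2"
    by (auto simp: e_def line_def)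
  then have "e \<in> seq.total"
    using seq.component_subset_total by blast
  moreover have "dg_module.obstruction (path_map n) n e \<noteq> 0"
    by (auto simp: obstruction_path_map[OF assms] e_def fun_eq_iff)
  ultimately show "dg_module.obstructed scale_seq line (\<lambda>v :: nat \<Rightarrow> 'k. 0) n (path_map n)"
    by (rule seq.obstructed_zero_differential)
qed

end
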